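(* There exist a one-variable polynomial $P$ and a two-variable polynomial $R$ (both absolute) such that the following holds. Let $p\in(0,1)$ and let $n$ be a positive integer such that $pn$ is an integer, and let $D_p$ be the uniform distribution on all $x\in\{\pm1\}^n$ with $\sum_{i=1}^n x_i=(1-2p)n$. Then for every multilinear polynomial $f$ of degree $d$ in $x_1,\dots,x_n$, $$\mathbb E_{x\sim D_p}[f(x)^4]\le P(d)\cdot C_p^{\,d}\cdot\Big(\mathbb E_{x\sim D_p}[f(x)^2]\Big)^2,\qquad C_p=R\Big(\tfrac1{1-p},\tfrac1p\Big).$$
   Context: All polynomials have real coefficients. In the source the bound is written $\mathrm{poly}(d)\cdot C_p^d$ with $C_p=\mathrm{poly}(\frac1{1-p},\frac1p)$; $P$ and $R$ make these two "poly" expressions explicit. *)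

theory Defs
  imports
    "HOL-Probability.Probability"
    "HOL-Library.Poly_Mapping"
    "HOL-Computational_Algebra.Polynomial"
begin

text \<open>Multivariate real polynomials in variables indexed by \<open>nat\<close>: finitely supported
  coefficient functions on monomials, a monomial being a finitely supported exponent function.\<close>

type_synonym mpolynomial = "(nat \<Rightarrow>\<^sub>0 nat) \<Rightarrow>\<^sub>0 real"

definition mvars :: "mpolynomial \<Rightarrow> nat set" where
  "mvars f = (\<Union>m\<in>Poly_Mapping.keys f. Poly_Mapping.keys m)"

definition multilinear_mpoly :: "mpolynomial \<Rightarrow> bool" where
  "multilinear_mpoly f \<longleftrightarrow>
     (\<forall>m\<in>Poly_Mapping.keys f. \<forall>i. Poly_Mapping.lookup m i \<le> 1)"

definition monomial_degree :: "(nat \<Rightarrow>\<^sub>0 nat) \<Rightarrow> nat" where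
  "monomial_degree m = (\<Sum>i\<in>Poly_Mapping.keys m. Poly_Mapping.lookup m i)"

text \<open>The inserted \<open>0\<close> only affects the zero polynomial, which gets degree \<open>0\<close>.\<close>

definition total_degree :: "mpolynomial \<Rightarrow> nat" where
  "total_degree f = Max (insert 0 (monomial_degree ` Poly_Mapping.keys f))"

definition eval_mpoly :: "mpolynomial \<Rightarrow> (nat \<Rightarrow> real) \<Rightarrow> real" where
  "eval_mpoly f x =
     (\<Sum>m\<in>Poly_Mapping.keys f. Poly_Mapping.lookup f m *
        (\<Prod>i\<in>Poly_Mapping.keys m. x i ^ Poly_Mapping.lookup m i))"

text \<open>A polynomial in two variables is a polynomial in the second one whose coefficients are
  polynomials in the first one.\<close>

definition eval_poly2 :: "real poly poly \<Rightarrow> real \<Rightarrow> real \<Rightarrow> real" where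
  "eval_poly2 R a b = poly (poly R [:b:]) a"

definition slice :: "nat \<Rightarrow> real \<Rightarrow> (nat \<Rightarrow> real) set" where
  "slice n p = {x \<in> {1..n} \<rightarrow>\<^sub>E {-1, 1}. (\<Sum>i=1..n. x i) = (1 - 2 * p) * real n}"

text \<open>For \<open>p \<in> (0,1)\<close> with \<open>p * n\<close> an integer the slice is finite and nonempty, as
  \<open>pmf_of_set\<close> requires.\<close>

definition slice_pmf :: "nat \<Rightarrow> real \<Rightarrow> (nat \<Rightarrow> real) pmf" where
  "slice_pmf n p = pmf_of_set (slice n p)"

end

theory Submission
  imports Defs
begin

text \<open>
  Identify the slice with the \<open>k\<close>-subsets \<open>S\<close> of an \<open>n\<close>-set, \<open>k = p n\<close>, and let \<open>L\<close> be the
  Laplacian of the walk that exchanges an element of \<open>S\<close> with one outside \<open>S\<close>. On functions of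
  degree \<open>d\<close>, \<open>L\<close> acts as \<open>\<lambda>\<^sub>d = d (n - d + 1)\<close> up to degree \<open>d - 1\<close>, so for
  \<open>d < min k (n - k)\<close> such a function is an orthogonal sum of eigenfunctions \<open>f\<^sub>j\<close> with
  eigenvalues \<open>\<lambda>\<^sub>j\<close>, \<open>j \<le> d\<close>.

  For one eigenfunction \<open>f\<close> of level \<open>j\<close> the fourth moment is bounded by induction on \<open>j\<close>, the
  gain over a Poincare argument coming from the factor \<open>1 / \<lambda>\<^sub>j\<close>:
  \<open>\<lambda>\<^sub>j E f^4 = E (f^3 L f)\<close> is at most \<open>3 / 2\<close> times the mean of \<open>(f S - f S')^2 f(S)^2\<close>, summed
  over all exchanges \<open>S \<rightarrow> S'\<close>. For a fixed exchanged pair \<open>{i, l}\<close> the difference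
  \<open>f S - f S'\<close> is an eigenfunction of level \<open>j - 1\<close> on the \<open>(k - 1)\<close>-subsets of the remaining
  \<open>n - 2\<close> points, so Cauchy--Schwarz and the induction hypothesis apply; the squared differences
  add up to \<open>2 \<lambda>\<^sub>j E f^2\<close>, and \<open>\<lambda>\<^sub>j\<close> cancels. Each step costs a factor \<open>9\<close> and the change of
  normalisation from \<open>n choose k\<close> to \<open>(n - 2) choose (k - 1)\<close>; the total change is at most
  \<open>(e^2 / (p (1 - p)))^j\<close>. If \<open>d \<ge> min k (n - k)\<close>, the trivial factor \<open>n choose k\<close> is already
  small enough.
\<close>

subsection \<open>The Laplacian of the Bernoulli--Laplace exchange walk\<close>

definition ksets :: "'a set \<Rightarrow> nat \<Rightarrow> 'a set set" where
  "ksets U k = {S. S \<subseteq> U \<and> card S = k}"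

text \<open>On \<open>k\<close>-subsets of an \<open>n\<close>-set this is \<open>k (n - k)\<close>
  times identity minus the transition operator of the walk. In this scaling the eigenvalues do not
  depend on \<open>k\<close>.\<close>

definition laplacian :: "'a set \<Rightarrow> ('a set \<Rightarrow> real) \<Rightarrow> 'a set \<Rightarrow> real" where
  "laplacian U f S = (\<Sum>i\<in>S. \<Sum>l\<in>U - S. f S - f (insert l (S - {i})))"

lemma finite_ksets [simp]: "finite U \<Longrightarrow> finite (ksets U k)"
  by (simp add: ksets_def)

lemma card_ksets: "finite U \<Longrightarrow> card (ksets U k) = card U choose k"
  by (simp add: ksets_def n_subsets)

lemma insert_ksets:
  assumes "finite U" "R \<in> ksets (U - {i, l}) k" "i \<in> U"
  shows "insert i R \<in> ksets U (Suc k)"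
  using assms by (auto simp: ksets_def card_insert_if finite_subset)

text \<open>An exchange is determined by the removed point \<open>i\<close>, the added point
  \<open>l\<close> and the common part \<open>R = S - {i}\<close>. Grouping by \<open>(i, l)\<close>
  exposes functions on the \<open>k\<close>-subsets of \<open>U - {i, l}\<close>, to which induction
  on the level can be applied.\<close>

lemma sum_exchange:
  fixes F :: "'a set \<Rightarrow> 'a set \<Rightarrow> real"
  assumes "finite U"
  shows "(\<Sum>S\<in>ksets U (Suc k). \<Sum>i\<in>S. \<Sum>l\<in>U - S. F S (insert l (S - {i}))) =
    (\<Sum>i\<in>U. \<Sum>l\<in>U - {i}. \<Sum>R\<in>ksets (U - {i, l}) k. F (insert i R) (insert l R))"
proof -
  have fin: "finite S" if "S \<in> ksets U m" for S m
    using that assms by (auto simp: ksets_def finite_subset)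
  have "(\<Sum>S\<in>ksets U (Suc k). \<Sum>i\<in>S. \<Sum>l\<in>U - S. F S (insert l (S - {i}))) =
    (\<Sum>(S, i, l)\<in>(SIGMA S:ksets U (Suc k). SIGMA i:S. U - S). F S (insert l (S - {i})))"
    using assms by (simp add: sum.Sigma fin)
  also have "\<dots> = (\<Sum>(i, l, R)\<in>(SIGMA i:U. SIGMA l:U - {i}. ksets (U - {i, l}) k).
      F (insert i R) (insert l R))"
    by (rule sum.reindex_bij_witness[where i = "\<lambda>(i, l, R). (insert i R, i, l)"
          and j = "\<lambda>(S, i, l). (i, l, S - {i})"])
      (use assms in \<open>auto simp: ksets_def insert_absorb card_insert_if finite_subset\<close>)
  also have "\<dots> = (\<Sum>i\<in>U. \<Sum>l\<in>U - {i}. \<Sum>R\<in>ksets (U - {i, l}) k. F (insert i R) (insert l R))"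
    using assms by (simp add: sum.Sigma)
  finally show ?thesis .
qed

text \<open>Reversibility of the walk: exchanging \<open>i\<close> for \<open>l\<close> is undone by
  exchanging \<open>l\<close> for \<open>i\<close>.\<close>

lemma sum_exchange_commute:
  fixes F :: "'a set \<Rightarrow> 'a set \<Rightarrow> real"
  assumes "finite U"
  shows "(\<Sum>S\<in>ksets U (Suc k). \<Sum>i\<in>S. \<Sum>l\<in>U - S. F S (insert l (S - {i}))) =
    (\<Sum>S\<in>ksets U (Suc k). \<Sum>i\<in>S. \<Sum>l\<in>U - S. F (insert l (S - {i})) S)"
proof -
  define h where "h i l = (\<Sum>R\<in>ksets (U - {i, l}) k. F (insert i R) (insert l R))" for i l
  \<comment> \<open>Padding the diagonal with zeros makes both index ranges equal to
    \<open>U\<close>, so the sums can be swapped.\<close>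
  have "(\<Sum>i\<in>U. \<Sum>l\<in>U - {i}. h i l) = (\<Sum>i\<in>U. \<Sum>l\<in>U. if i = l then 0 else h i l)"
    using assms by (intro sum.cong refl sum.mono_neutral_cong_left) auto
  also have "\<dots> = (\<Sum>i\<in>U. \<Sum>l\<in>U. if i = l then 0 else h l i)"
    by (subst sum.swap) (intro sum.cong refl, auto)
  also have "\<dots> = (\<Sum>i\<in>U. \<Sum>l\<in>U - {i}. h l i)"
    using assms by (intro sum.cong refl sum.mono_neutral_cong_right) auto
  finally show ?thesis
    unfolding sum_exchange[OF assms] sum_exchange[OF assms, where F = "\<lambda>S T. F T S"] h_def
    by (simp add: insert_commute)
qed

text \<open>Summation by parts: averaging the left side with its reversed form gives the Dirichlet
  form, which is symmetric in \<open>h\<close> and \<open>f\<close>.\<close>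

lemma sum_mult_laplacian:
  assumes "finite U"
  shows "(\<Sum>S\<in>ksets U (Suc k). h S * laplacian U f S) =
    (\<Sum>S\<in>ksets U (Suc k). \<Sum>i\<in>S. \<Sum>l\<in>U - S.
      (h S - h (insert l (S - {i}))) * (f S - f (insert l (S - {i})))) / 2"
proof -
  have A: "(\<Sum>S\<in>ksets U (Suc k). h S * laplacian U f S) =
    (\<Sum>S\<in>ksets U (Suc k). \<Sum>i\<in>S. \<Sum>l\<in>U - S. h S * (f S - f (insert l (S - {i}))))"
    by (simp add: laplacian_def sum_distrib_left)
  also have B: "\<dots> = (\<Sum>S\<in>ksets U (Suc k). \<Sum>i\<in>S. \<Sum>l\<in>U - S.
      h (insert l (S - {i})) * (f (insert l (S - {i})) - f S))"
    by (rule sum_exchange_commute[OF assms, where F = "\<lambda>S T. h S * (f S - f T)"])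
  finally have "2 * (\<Sum>S\<in>ksets U (Suc k). h S * laplacian U f S) =
    (\<Sum>S\<in>ksets U (Suc k). \<Sum>i\<in>S. \<Sum>l\<in>U - S. h S * (f S - f (insert l (S - {i})))) +
    (\<Sum>S\<in>ksets U (Suc k). \<Sum>i\<in>S. \<Sum>l\<in>U - S.
      h (insert l (S - {i})) * (f (insert l (S - {i})) - f S))"
    using A B by linarith
  also have "\<dots> = (\<Sum>S\<in>ksets U (Suc k). \<Sum>i\<in>S. \<Sum>l\<in>U - S.
      (h S - h (insert l (S - {i}))) * (f S - f (insert l (S - {i}))))"
    unfolding sum.distrib[symmetric] by (simp add: algebra_simps)
  finally show ?thesis by simp
qed

lemma laplacian_self_adjoint:
  assumes "finite U"
  shows "(\<Sum>S\<in>ksets U (Suc k). h S * laplacian U f S) =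
    (\<Sum>S\<in>ksets U (Suc k). f S * laplacian U h S)"
  by (simp add: sum_mult_laplacian[OF assms] mult.commute)

text \<open>Exchanges that remove the distinguished point or insert the other one lead to the same
  sets from \<open>insert a R\<close> and \<open>insert b R\<close>, except for the direct swap of
  \<open>a\<close> and \<open>b\<close>. In the difference they leave
  \<open>2 + card R + card W = card U\<close> copies of
  \<open>f (insert a R) - f (insert b R)\<close>; the remaining exchanges form the smaller
  Laplacian. Hence differences of eigenfunctions are again eigenfunctions.\<close>

lemma laplacian_difference:
  assumes fin: "finite U" and ab: "a \<in> U" "b \<in> U" "a \<noteq> b"
    and R: "R \<in> ksets (U - {a, b}) k"
  shows "laplacian (U - {a, b}) (\<lambda>R. f (insert a R) - f (insert b R)) R =
    laplacian U f (insert a R) - laplacian U f (insert b R)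
      - real (card U) * (f (insert a R) - f (insert b R))"
proof -
  define W where "W = U - {a, b} - R"
  have RU: "R \<subseteq> U" "a \<notin> R" "b \<notin> R" using R by (auto simp: ksets_def)
  have finR: "finite R" "finite W" using RU fin finite_subset W_def by auto
  have W: "a \<notin> W" "b \<notin> W" "U - insert a R = insert b W" "U - insert b R = insert a W"
    using ab RU by (auto simp: W_def)
  have "U = insert a (insert b (R \<union> W))" using ab RU by (auto simp: W_def)
  moreover have "R \<inter> W = {}" by (auto simp: W_def)
  ultimately have cardU: "card U = 2 + card R + card W"
    using finR RU W ab by (simp add: card_Un_disjoint)
  define g where "g R = f (insert a R) - f (insert b R)" for R
  \<comment> \<open>The exchanges split into four groups: is \<open>c\<close> or a point of
    \<open>R\<close> removed, is \<open>e\<close> or a point of \<open>W\<close> inserted. The names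
    \<open>c\<close>, \<open>e\<close> let one expansion serve both starting sets.\<close>
  have exp: "laplacian U f (insert c R) = f (insert c R) - f (insert e R) +
      (\<Sum>l\<in>W. f (insert c R) - f (insert l R)) +
      ((\<Sum>i\<in>R. f (insert c R) - f (insert a (insert b (R - {i})))) +
      (\<Sum>i\<in>R. \<Sum>l\<in>W. f (insert c R) - f (insert c (insert l (R - {i})))))"
    if "{c, e} = {a, b}" "c \<noteq> e" for c e
  proof -
    have *: "c \<notin> R" "e \<notin> W" "U - insert c R = insert e W" "insert c R - {c} = R"
      using that ab RU W by (auto simp: doubleton_eq_iff)
    have **: "insert e (insert c R - {i}) = insert a (insert b (R - {i}))"
       "insert c (insert e (R - {i})) = insert a (insert b (R - {i}))"
       "insert l (insert c R - {i}) = insert c (insert l (R - {i}))"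
      if "i \<in> R" for i l using that * \<open>{c, e} = {a, b}\<close> by (auto simp: doubleton_eq_iff)
    show ?thesis using * finR unfolding laplacian_def
      by (simp add: sum.distrib ** del: sum_subtractf sum_constant cong: sum.cong)
  qed
  have "laplacian U f (insert a R) - laplacian U f (insert b R) =
    2 * g R + (\<Sum>l\<in>W. g R) + (\<Sum>i\<in>R. g R) + (\<Sum>i\<in>R. \<Sum>l\<in>W. g R - g (insert l (R - {i})))"
    unfolding exp[OF refl ab(3)] exp[OF insert_commute ab(3)[symmetric]] g_def
    by (simp add: sum_subtractf sum.distrib algebra_simps)
  moreover have "laplacian (U - {a, b}) g R = (\<Sum>i\<in>R. \<Sum>l\<in>W. g R - g (insert l (R - {i})))"
    by (simp add: laplacian_def W_def)
  moreover have "2 * g R + (\<Sum>l\<in>W. g R) + (\<Sum>i\<in>R. g R) = card U * g R"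
    by (simp add: cardU algebra_simps)
  ultimately show ?thesis by (simp add: g_def[abs_def])
qed

text \<open>The Dirichlet form of \<open>f\<close> with itself vanishes, so no exchange changes
  \<open>f\<close>, and exchanges connect all \<open>k\<close>-subsets. This is level 0 of the
  induction on eigenfunctions.\<close>

lemma harmonic_imp_constant:
  assumes fin: "finite U" and harm: "\<And>S. S \<in> ksets U k \<Longrightarrow> laplacian U f S = 0"
    and "S \<in> ksets U k" "T \<in> ksets U k"
  shows "f S = f T"
proof (cases k)
  case 0
  then show ?thesis using assms by (auto simp: ksets_def finite_subset)
next
  case (Suc k')
  have fink: "finite S" if "S \<in> ksets U k" for S
    using that fin by (auto simp: ksets_def finite_subset)
  have sum0: "(\<Sum>S\<in>ksets U k. \<Sum>i\<in>S. \<Sum>l\<in>U - S. (f S - f (insert l (S - {i})))\<^sup>2) = 0"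
    using sum_mult_laplacian[OF fin, where h = f and f = f and k = k'] harm Suc
    by (simp add: power2_eq_square)
  have step: "f S = f (insert l (S - {i}))"
    if "S \<in> ksets U k" "i \<in> S" "l \<in> U - S" for S i l
  proof -
    have "(\<Sum>i\<in>S. \<Sum>l\<in>U - S. (f S - f (insert l (S - {i})))\<^sup>2) = 0"
      using sum0 that fin by (subst (asm) sum_nonneg_eq_0_iff) (auto intro!: sum_nonneg)
    then have "(\<Sum>l\<in>U - S. (f S - f (insert l (S - {i})))\<^sup>2) = 0"
      using that fink by (subst (asm) sum_nonneg_eq_0_iff) (auto intro!: sum_nonneg)
    then have "(f S - f (insert l (S - {i})))\<^sup>2 = 0"
      using that fin by (subst (asm) sum_nonneg_eq_0_iff) auto
    then show ?thesis by simp
  qed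
  from \<open>S \<in> ksets U k\<close> show ?thesis
  \<comment> \<open>Exchanging a point of \<open>S - T\<close> for one of \<open>T - S\<close>
    brings \<open>S\<close> one step closer to \<open>T\<close>.\<close>
  proof (induction "card (S - T)" arbitrary: S)
    case 0
    then have "S \<subseteq> T" using fink by auto
    moreover have "card S = card T" using 0 assms(4) by (simp add: ksets_def)
    ultimately have "S = T" using card_subset_eq[OF fink[OF assms(4)]] by simp
    then show ?case by simp
  next
    case (Suc m)
    then have "S - T \<noteq> {}" by force
    then obtain i where i: "i \<in> S" "i \<notin> T" by auto
    have "card S = card T" using Suc.prems assms(4) by (simp add: ksets_def)
    then have "\<not> T \<subseteq> S" using i card_subset_eq[OF fink[OF Suc.prems], of T] by auto
    then obtain l where l: "l \<in> T" "l \<notin> S" by auto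
    have "insert l (S - {i}) \<in> ksets U k"
      using Suc.prems assms(4) i l fink[OF Suc.prems] card_Suc_Diff1[OF fink[OF Suc.prems] i(1)]
      by (auto simp: ksets_def simp del: card_Diff_insert)
    moreover have "insert l (S - {i}) - T = S - T - {i}" using l by auto
    then have "m = card (insert l (S - {i}) - T)"
      using Suc.hyps(2) i fink[OF Suc.prems] by simp
    ultimately have "f (insert l (S - {i})) = f T" using Suc.hyps(1) by blast
    moreover have "l \<in> U - S" using l assms(4) by (auto simp: ksets_def)
    ultimately show ?case using step[OF Suc.prems i(1)] by simp
  qed
qed

subsection \<open>Fourth moments of eigenfunctions\<close>

text \<open>The right side exceeds the left by \<open>(a - b)^4 / 2\<close>. The mixed term
  \<open>a b\<close> is thereby traded for squares, which reversibility can merge.\<close>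

lemma cubic_difference_le:
  fixes a b :: real
  shows "(a ^ 3 - b ^ 3) * (a - b) \<le> 3 / 2 * ((a - b)\<^sup>2 * (a\<^sup>2 + b\<^sup>2))"
proof -
  have "0 \<le> (a - b)\<^sup>2 * ((a - b)\<^sup>2 / 2)" by simp
  also have "\<dots> = 3 / 2 * ((a - b)\<^sup>2 * (a\<^sup>2 + b\<^sup>2)) - (a ^ 3 - b ^ 3) * (a - b)"
    by (simp add: power2_eq_square power3_eq_cube field_simps)
  finally show ?thesis by simp
qed

lemma sum_fourth_powers_eigenfunction_le:
  assumes fin: "finite U"
    and eig: "\<And>S. S \<in> ksets U (Suc k) \<Longrightarrow> laplacian U f S = \<mu> * f S"
  shows "\<mu> * (\<Sum>S\<in>ksets U (Suc k). f S ^ 4) \<le>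
    3 / 2 * (\<Sum>i\<in>U. \<Sum>l\<in>U - {i}. \<Sum>R\<in>ksets (U - {i, l}) k.
      (f (insert i R) - f (insert l R))\<^sup>2 * (f (insert i R))\<^sup>2)"
proof -
  have "\<mu> * (\<Sum>S\<in>ksets U (Suc k). f S ^ 4) = (\<Sum>S\<in>ksets U (Suc k). f S ^ 3 * laplacian U f S)"
    by (simp add: eig sum_distrib_left power_numeral_reduce algebra_simps)
  also have "\<dots> = (\<Sum>S\<in>ksets U (Suc k). \<Sum>i\<in>S. \<Sum>l\<in>U - S.
      (f S ^ 3 - f (insert l (S - {i})) ^ 3) * (f S - f (insert l (S - {i})))) / 2"
    by (rule sum_mult_laplacian[OF fin, where h = "\<lambda>S. f S ^ 3"])
  also have "\<dots> \<le> (\<Sum>S\<in>ksets U (Suc k). \<Sum>i\<in>S. \<Sum>l\<in>U - S.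
      3 / 2 * ((f S - f (insert l (S - {i})))\<^sup>2 * ((f S)\<^sup>2 + (f (insert l (S - {i})))\<^sup>2))) / 2"
    by (intro divide_right_mono sum_mono cubic_difference_le) simp
  \<comment> \<open>The two squares contribute equally after reversing the exchanges, which turns
    3/4 into 3/2.\<close>
  also have "\<dots> = 3 / 4 * ((\<Sum>S\<in>ksets U (Suc k). \<Sum>i\<in>S. \<Sum>l\<in>U - S.
        (f S - f (insert l (S - {i})))\<^sup>2 * (f S)\<^sup>2) +
      (\<Sum>S\<in>ksets U (Suc k). \<Sum>i\<in>S. \<Sum>l\<in>U - S.
        (f S - f (insert l (S - {i})))\<^sup>2 * (f (insert l (S - {i})))\<^sup>2))"
    by (simp only: sum_distrib_left[symmetric] sum.distrib distrib_left) simp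
  also have "(\<Sum>S\<in>ksets U (Suc k). \<Sum>i\<in>S. \<Sum>l\<in>U - S.
        (f S - f (insert l (S - {i})))\<^sup>2 * (f (insert l (S - {i})))\<^sup>2) =
      (\<Sum>S\<in>ksets U (Suc k). \<Sum>i\<in>S. \<Sum>l\<in>U - S.
        (f S - f (insert l (S - {i})))\<^sup>2 * (f S)\<^sup>2)"
    by (subst sum_exchange_commute[OF fin, where F = "\<lambda>S T. (f S - f T)\<^sup>2 * (f T)\<^sup>2"])
      (simp add: power2_commute)
  finally show ?thesis
    unfolding sum_exchange[OF fin, where F = "\<lambda>S T. (f S - f T)\<^sup>2 * (f S)\<^sup>2"] by simp
qed

lemma sum_squared_differences_eigenfunction:
  assumes fin: "finite U"
    and eig: "\<And>S. S \<in> ksets U (Suc k) \<Longrightarrow> laplacian U f S = \<mu> * f S"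
  shows "(\<Sum>i\<in>U. \<Sum>l\<in>U - {i}. \<Sum>R\<in>ksets (U - {i, l}) k.
      (f (insert i R) - f (insert l R))\<^sup>2) = 2 * \<mu> * (\<Sum>S\<in>ksets U (Suc k). (f S)\<^sup>2)"
proof -
  have "\<mu> * (\<Sum>S\<in>ksets U (Suc k). (f S)\<^sup>2) = (\<Sum>S\<in>ksets U (Suc k). f S * laplacian U f S)"
    by (simp add: eig sum_distrib_left power2_eq_square algebra_simps)
  also have "\<dots> = (\<Sum>S\<in>ksets U (Suc k). \<Sum>i\<in>S. \<Sum>l\<in>U - S. (f S - f (insert l (S - {i})))\<^sup>2) / 2"
    by (simp add: sum_mult_laplacian[OF fin] power2_eq_square)
  finally show ?thesis
    unfolding sum_exchange[OF fin, where F = "\<lambda>S T. (f S - f T)\<^sup>2"] by simp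
qed

lemma sum_insert_le:
  fixes f :: "'a set \<Rightarrow> real"
  assumes "finite U" "i \<in> U" "\<And>S. 0 \<le> f S"
  shows "(\<Sum>R\<in>ksets (U - {i, l}) k. f (insert i R)) \<le> (\<Sum>S\<in>ksets U (Suc k). f S)"
proof -
  have "inj_on (insert i) (ksets (U - {i, l}) k)"
    by (auto simp: inj_on_def ksets_def insert_eq_iff)
  then have "(\<Sum>R\<in>ksets (U - {i, l}) k. f (insert i R)) =
      (\<Sum>S\<in>insert i ` ksets (U - {i, l}) k. f S)"
    by (simp add: sum.reindex)
  also have "\<dots> \<le> (\<Sum>S\<in>ksets U (Suc k). f S)"
    using assms insert_ksets by (intro sum_mono2) fastforce+
  finally show ?thesis .
qed

text \<open>The \<open>j\<close>-th Laplacian eigenvalue of the Johnson graph on the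
  \<open>k\<close>-subsets of an \<open>n\<close>-set.\<close>

definition eigenvalue :: "nat \<Rightarrow> nat \<Rightarrow> real" where
  "eigenvalue n j = real j * (real n - real j + 1)"

text \<open>The binomial is chosen to be invariant under lowering \<open>card U\<close> by 2 and
  \<open>k\<close>, \<open>j\<close> by 1, so it passes through the induction unchanged. At level 0
  it is the number of \<open>k\<close>-subsets and equality holds.\<close>

lemma eigenfunction_fourth_moment_le:
  assumes "finite U" "j \<le> k" "j + k \<le> card U"
    and "\<And>S. S \<in> ksets U k \<Longrightarrow> laplacian U f S = eigenvalue (card U) j * f S"
  shows "real ((card U - 2 * j) choose (k - j)) * (\<Sum>S\<in>ksets U k. f S ^ 4) \<le>
    9 ^ j * (\<Sum>S\<in>ksets U k. (f S)\<^sup>2)\<^sup>2"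
  using assms
proof (induction j arbitrary: U k f)
  case 0
  have harm: "laplacian U f S = 0" if "S \<in> ksets U k" for S
    using 0(4)[OF that] by (simp add: eigenvalue_def)
  define c where "c = f (SOME S. S \<in> ksets U k)"
  have "f S = c" if "S \<in> ksets U k" for S
    unfolding c_def using that by (intro harmonic_imp_constant[OF 0(1) harm]) (auto intro: someI)
  then show ?case using 0(1)
    by (simp add: card_ksets power2_eq_square power_numeral_reduce algebra_simps)
next
  case (Suc j)
  from Suc.prems obtain k' where k: "k = Suc k'" "j \<le> k'" by (cases k) auto
  define A where "A = (\<Sum>S\<in>ksets U k. f S ^ 4)"
  define B where "B = (\<Sum>S\<in>ksets U k. (f S)\<^sup>2)"
  define b where "b = real ((card U - 2 * Suc j) choose (k - Suc j))"
  define ev where "ev = eigenvalue (card U) (Suc j)"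
  have nine: "(9 :: real) ^ j = (3 ^ j)\<^sup>2"
    by (simp add: power2_eq_square power_mult_distrib[symmetric])
  have nonneg: "0 \<le> A" "0 \<le> B" "0 \<le> b"
    by (auto simp: A_def B_def b_def intro: sum_nonneg)
  have ev: "0 < ev" using Suc.prems by (simp add: ev_def eigenvalue_def)
  have eig: "laplacian U f S = ev * f S" if "S \<in> ksets U (Suc k')" for S
    using Suc.prems(4) that k by (simp add: ev_def)
  \<comment> \<open>Square roots keep this bound linear in the squared differences, so it can be
    summed over all pairs.\<close>
  have pair: "sqrt b * (\<Sum>R\<in>ksets (U - {i, l}) k'. (f (insert i R) - f (insert l R))\<^sup>2 * (f (insert i R))\<^sup>2)
      \<le> 3 ^ j * sqrt A * (\<Sum>R\<in>ksets (U - {i, l}) k'. (f (insert i R) - f (insert l R))\<^sup>2)"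
    if il: "i \<in> U" "l \<in> U" "i \<noteq> l" for i l
  proof -
    define V where "V = U - {i, l}"
    define g where "g R = f (insert i R) - f (insert l R)" for R
    define G where "G = (\<Sum>R\<in>ksets V k'. (g R)\<^sup>2)"
    have cardV: "card U = card V + 2" 
      using il Suc.prems(1) card_Diff_subset[of "{i, l}" U] card_mono[of U "{i, l}"]
      by (simp add: V_def)
    have "real ((card V - 2 * j) choose (k' - j)) * (\<Sum>R\<in>ksets V k'. g R ^ 4) \<le> 9 ^ j * G\<^sup>2"
      unfolding G_def
    proof (rule Suc.IH)
      show "finite V" "j \<le> k'" "j + k' \<le> card V"
        using Suc.prems k cardV by (auto simp: V_def)
      fix R assume R: "R \<in> ksets V k'"
      have "insert i R \<in> ksets U (Suc k')" "insert l R \<in> ksets U (Suc k')"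
        using R il Suc.prems(1) insert_ksets[of U R i l k'] insert_ksets[of U R l i k']
        by (simp_all add: V_def insert_commute)
      then have "laplacian V g R = (ev - real (card U)) * g R"
        using laplacian_difference[of U i l R k' f] Suc.prems(1) il R eig
        by (simp add: V_def g_def[abs_def] algebra_simps)
      \<comment> \<open>This is \<open>(j + 1) (n - j) - n = j (n - j - 1)\<close> with
        \<open>n = card V + 2\<close>.\<close>
      also have "ev - real (card U) = eigenvalue (card V) j"
        by (simp add: ev_def eigenvalue_def cardV algebra_simps)
      finally show "laplacian V g R = eigenvalue (card V) j * g R" .
    qed
    then have IH: "b * (\<Sum>R\<in>ksets V k'. g R ^ 4) \<le> 9 ^ j * G\<^sup>2"
      by (simp add: b_def k cardV)
    have "(\<Sum>R\<in>ksets V k'. (g R)\<^sup>2 * (f (insert i R))\<^sup>2)\<^sup>2 \<le>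
        (\<Sum>R\<in>ksets V k'. ((g R)\<^sup>2)\<^sup>2) * (\<Sum>R\<in>ksets V k'. ((f (insert i R))\<^sup>2)\<^sup>2)"
      by (rule Cauchy_Schwarz_ineq_sum)
    also have "\<dots> \<le> (\<Sum>R\<in>ksets V k'. g R ^ 4) * A"
      using sum_insert_le[of U i "\<lambda>S. f S ^ 4" l k'] Suc.prems(1) il
      by (auto simp: A_def V_def k intro!: mult_left_mono sum_nonneg)
    finally have "b * (\<Sum>R\<in>ksets V k'. (g R)\<^sup>2 * (f (insert i R))\<^sup>2)\<^sup>2 \<le>
        b * (\<Sum>R\<in>ksets V k'. g R ^ 4) * A"
      using nonneg by (simp add: mult_left_mono mult.assoc)
    also have "\<dots> \<le> 9 ^ j * G\<^sup>2 * A"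
      using IH nonneg by (intro mult_right_mono)
    finally have "sqrt (b * (\<Sum>R\<in>ksets V k'. (g R)\<^sup>2 * (f (insert i R))\<^sup>2)\<^sup>2) \<le> sqrt (9 ^ j * G\<^sup>2 * A)"
      by simp
    moreover have "sqrt (9 ^ j * G\<^sup>2 * A) = 3 ^ j * sqrt A * G"
    proof -
      have "0 \<le> G" by (auto simp: G_def intro: sum_nonneg)
      then show ?thesis by (simp add: nine real_sqrt_mult)
    qed
    moreover have "0 \<le> (\<Sum>R\<in>ksets V k'. (g R)\<^sup>2 * (f (insert i R))\<^sup>2)"
      by (auto intro: sum_nonneg)
    moreover have "sqrt (b * (\<Sum>R\<in>ksets V k'. (g R)\<^sup>2 * (f (insert i R))\<^sup>2)\<^sup>2) =
        sqrt b * \<bar>\<Sum>R\<in>ksets V k'. (g R)\<^sup>2 * (f (insert i R))\<^sup>2\<bar>"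
      by (simp add: real_sqrt_mult)
    ultimately have "sqrt b * (\<Sum>R\<in>ksets V k'. (g R)\<^sup>2 * (f (insert i R))\<^sup>2) \<le> 3 ^ j * sqrt A * G"
      by linarith
    then show ?thesis by (simp add: G_def V_def g_def)
  qed
  have "ev * (sqrt b * A) \<le> 3 / 2 * (\<Sum>i\<in>U. \<Sum>l\<in>U - {i}. sqrt b * (\<Sum>R\<in>ksets (U - {i, l}) k'.
      (f (insert i R) - f (insert l R))\<^sup>2 * (f (insert i R))\<^sup>2))"
    using mult_left_mono[OF sum_fourth_powers_eigenfunction_le[OF Suc.prems(1) eig], where c = "sqrt b"] nonneg
    by (simp add: A_def k sum_distrib_left[symmetric] ac_simps)
  also have "\<dots> \<le> 3 / 2 * (\<Sum>i\<in>U. \<Sum>l\<in>U - {i}. 3 ^ j * sqrt A * (\<Sum>R\<in>ksets (U - {i, l}) k'.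
      (f (insert i R) - f (insert l R))\<^sup>2))"
    by (intro mult_left_mono sum_mono pair) auto
  also have "\<dots> = 3 / 2 * (3 ^ j * sqrt A * (2 * ev * B))"
    using sum_squared_differences_eigenfunction[OF Suc.prems(1) eig]
    by (simp add: B_def k sum_distrib_left[symmetric])
  \<comment> \<open>Each level costs 3/2 * 2 = 3, hence 9 after the final squaring;
    \<open>ev\<close> now stands on both sides and cancels.\<close>
  also have "\<dots> = ev * (3 ^ Suc j * B * sqrt A)"
    by simp
  finally have "sqrt b * A \<le> 3 ^ Suc j * B * sqrt A"
    using ev by simp
  then have "(sqrt b * sqrt A) * sqrt A \<le> (3 ^ Suc j * B) * sqrt A"
    using nonneg by (simp add: mult.assoc)
  then have "sqrt b * sqrt A \<le> 3 ^ Suc j * B"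
    using nonneg by (cases "A = 0") (auto simp: mult_le_cancel_right)
  then have "(sqrt b * sqrt A)\<^sup>2 \<le> (3 ^ Suc j * B)\<^sup>2"
    using nonneg by (intro power_mono) auto
  then show ?case
    using nonneg unfolding A_def[symmetric] B_def[symmetric] b_def[symmetric]
    by (simp add: power_mult_distrib nine)
qed

subsection \<open>Low-degree functions\<close>

text \<open>Polynomials of degree at most \<open>d\<close> in the 0/1 membership variables, taken
  only up to equality on the \<open>k\<close>-subsets: the indicator of
  \<open>A \<subseteq> S\<close> is the monomial with variable set \<open>A\<close>.\<close>

definition low_degree :: "'a set \<Rightarrow> nat \<Rightarrow> nat \<Rightarrow> ('a set \<Rightarrow> real) \<Rightarrow> bool" where
  "low_degree U k d f \<longleftrightarrow>
     (\<exists>c. \<forall>S\<in>ksets U k. f S = (\<Sum>A | A \<subseteq> U \<and> card A \<le> d. c A * of_bool (A \<subseteq> S)))"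

lemma low_degree_cong:
  "(\<And>S. S \<in> ksets U k \<Longrightarrow> f S = g S) \<Longrightarrow> low_degree U k d f \<longleftrightarrow> low_degree U k d g"
  by (simp add: low_degree_def)

lemma low_degree_subset_indicator:
  assumes "finite U" "A \<subseteq> U" "card A \<le> d"
  shows "low_degree U k d (\<lambda>S. of_bool (A \<subseteq> S))"
  unfolding low_degree_def
proof (intro exI ballI)
  fix S
  have "(\<Sum>B | B \<subseteq> U \<and> card B \<le> d. of_bool (B = A) * of_bool (B \<subseteq> S)) =
      (\<Sum>B\<in>{A}. of_bool (B = A) * (of_bool (B \<subseteq> S) :: real))"
    using assms by (intro sum.mono_neutral_right) auto
  then show "of_bool (A \<subseteq> S) =
      (\<Sum>B | B \<subseteq> U \<and> card B \<le> d. of_bool (B = A) * (of_bool (B \<subseteq> S) :: real))"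
    by simp
qed

lemma low_degree_zero: "low_degree U k d (\<lambda>S. 0)"
  unfolding low_degree_def by (intro exI[of _ "\<lambda>_. 0"]) simp

lemma low_degree_add:
  assumes "low_degree U k d f" "low_degree U k d g"
  shows "low_degree U k d (\<lambda>S. f S + g S)"
proof -
  from assms obtain c e where
    "\<forall>S\<in>ksets U k. f S = (\<Sum>A | A \<subseteq> U \<and> card A \<le> d. c A * of_bool (A \<subseteq> S))"
    "\<forall>S\<in>ksets U k. g S = (\<Sum>A | A \<subseteq> U \<and> card A \<le> d. e A * of_bool (A \<subseteq> S))"
    unfolding low_degree_def by blast
  then show ?thesis unfolding low_degree_def
    by (intro exI[of _ "\<lambda>A. c A + e A"]) (simp add: sum.distrib[symmetric] distrib_right)
qed

lemma low_degree_scale: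
  assumes "low_degree U k d f"
  shows "low_degree U k d (\<lambda>S. r * f S)"
proof -
  from assms obtain c where
    "\<forall>S\<in>ksets U k. f S = (\<Sum>A | A \<subseteq> U \<and> card A \<le> d. c A * of_bool (A \<subseteq> S))"
    unfolding low_degree_def by blast
  then show ?thesis unfolding low_degree_def
    by (intro exI[of _ "\<lambda>A. r * c A"]) (simp add: sum_distrib_left mult.assoc)
qed

lemma low_degree_sum:
  assumes "\<And>x. x \<in> X \<Longrightarrow> low_degree U k d (f x)"
  shows "low_degree U k d (\<lambda>S. \<Sum>x\<in>X. f x S)"
  using assms
  by (induction X rule: infinite_finite_induct) (auto intro: low_degree_zero low_degree_add)

section \<open>Action of the Laplacian on low-degree functions\<close>

lemma laplacian_sum:
  "laplacian U (\<lambda>S. \<Sum>x\<in>X. f x S) S = (\<Sum>x\<in>X. laplacian U (f x) S)"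
  unfolding laplacian_def sum_subtractf[symmetric]
  by (simp add: sum.swap[of _ X])

lemma laplacian_scale: "laplacian U (\<lambda>S. r * f S) S = r * laplacian U f S"
  by (simp add: laplacian_def sum_distrib_left right_diff_distrib)

lemma laplacian_diff: "laplacian U (\<lambda>S. f S - g S) S = laplacian U f S - laplacian U g S"
  by (simp add: laplacian_def sum_subtractf[symmetric] algebra_simps)

lemma laplacian_cong:
  assumes "finite U" "S \<in> ksets U k" "\<And>S. S \<in> ksets U k \<Longrightarrow> f S = g S"
  shows "laplacian U f S = laplacian U g S"
  unfolding laplacian_def
proof (intro sum.cong refl)
  fix i l assume "i \<in> S" "l \<in> U - S"
  moreover have "finite S" using assms finite_subset by (auto simp: ksets_def)
  moreover have "Suc (card S - Suc 0) = card S"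
    using card_Suc_Diff1[OF \<open>finite S\<close> \<open>i \<in> S\<close>] \<open>i \<in> S\<close> \<open>finite S\<close> by simp
  ultimately have "insert l (S - {i}) \<in> ksets U k" using assms(2)
    by (auto simp: ksets_def)
  then show "f S - f (insert l (S - {i})) = g S - g (insert l (S - {i}))"
    using assms by simp
qed

text \<open>If \<open>A \<subseteq> S\<close>, an exchange destroys this exactly when it removes a
  point of \<open>A\<close>. If a single point \<open>m\<close> of \<open>A\<close> is missing, an
  exchange repairs this exactly when it inserts \<open>m\<close> and removes one of the
  \<open>k - card A + 1\<close> points of \<open>S - A\<close>. With two or more missing points no
  exchange matters. The formula makes the Laplacian triangular with respect to degree.\<close>

lemma laplacian_subset_indicator:
  assumes U: "finite U" and S: "S \<in> ksets U k" and A: "A \<subseteq> U"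
  shows "laplacian U (\<lambda>S. of_bool (A \<subseteq> S)) S = eigenvalue (card U) (card A) * of_bool (A \<subseteq> S) -
    (real k - real (card A) + 1) * (\<Sum>i\<in>A. of_bool (A - {i} \<subseteq> S))"
proof -
  have fin: "finite S" "finite A" "finite (U - S)"
    using assms finite_subset by (auto simp: ksets_def)
  have cardU: "real (card (U - S)) = real (card U) - real k"
    using S U fin card_mono[of U S] by (auto simp: ksets_def card_Diff_subset of_nat_diff)
  consider "A \<subseteq> S" | m where "m \<in> A" "A - S = {m}" | "\<not> A \<subseteq> S" "\<And>m. A - S \<noteq> {m}"
    by (metis DiffD1 insertI1)
  then show ?thesis
  proof cases
    case 1
    have "laplacian U (\<lambda>S. of_bool (A \<subseteq> S)) S = (\<Sum>i\<in>S. \<Sum>l\<in>U - S. of_bool (i \<in> A))"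
      unfolding laplacian_def using 1 by (intro sum.cong refl) (auto simp: of_bool_def)
    also have "\<dots> = (real (card U) - real k) * (\<Sum>i\<in>S. of_bool (i \<in> A))"
      by (simp add: cardU sum_distrib_left)
    also have "(\<Sum>i\<in>S. of_bool (i \<in> A) :: real) = real (card A)"
      using fin 1 by (simp add: sum.If_cases of_bool_def Int_absorb1)
    finally show ?thesis using 1 by (auto simp: eigenvalue_def algebra_simps subset_eq)
  next
    case (2 m)
    have m: "m \<notin> S" "m \<in> U - S" "\<not> A \<subseteq> S" using 2 A by auto
    have "laplacian U (\<lambda>S. of_bool (A \<subseteq> S)) S = (\<Sum>i\<in>S. \<Sum>l\<in>U - S. if l = m then - of_bool (i \<notin> A) else 0)"
      unfolding laplacian_def using 2 m by (intro sum.cong refl) (auto simp: of_bool_def)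
    also have "\<dots> = - (\<Sum>i\<in>S. of_bool (i \<notin> A))"
      using fin m by (simp add: sum_negf)
    also have "(\<Sum>i\<in>S. of_bool (i \<notin> A) :: real) = real (card (S - A))"
      using fin by (simp add: sum.If_cases of_bool_def Diff_eq Compl_eq)
    also have "card (S - A) = card S - card (S \<inter> A)"
      using fin by (simp add: card_Diff_subset_Int)
    also have "S \<inter> A = A - {m}" using 2 by auto
    also have "real (card S - card (A - {m})) = real k - real (card A) + 1"
    proof -
      have "card (A - {m}) \<le> card S" using 2 fin by (intro card_mono) auto
      moreover have "Suc (card (A - {m})) = card A" using 2 fin card_Suc_Diff1 by metis
      ultimately show ?thesis using S by (auto simp: ksets_def)
    qed
    finally have L: "laplacian U (\<lambda>S. of_bool (A \<subseteq> S)) S = - (real k - real (card A) + 1)" .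
    have "(\<Sum>i\<in>A. of_bool (A - {i} \<subseteq> S) :: real) = (\<Sum>i\<in>A. if i = m then 1 else 0)"
      using 2 by (intro sum.cong refl) auto
    also have "\<dots> = 1" using 2 fin by simp
    finally show ?thesis using L m by simp
  next
    case 3
    have "\<not> A \<subseteq> insert l (S - {i})" for i l using 3 by auto
    moreover have "\<not> A - {i} \<subseteq> S" if "i \<in> A" for i using 3 that by auto
    ultimately show ?thesis using 3 by (simp add: laplacian_def)
  qed
qed

text \<open>Subtracting the eigenvalue cancels the diagonal term of every monomial of size
  \<open>Suc d\<close>, leaving only its subsets \<open>A - {i}\<close>; smaller monomials already
  have degree at most \<open>d\<close>.\<close>

lemma low_degree_laplacian_diff:
  assumes U: "finite U" and f: "low_degree U k (Suc d) f"
  shows "low_degree U k d (\<lambda>S. laplacian U f S - eigenvalue (card U) (Suc d) * f S)"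
proof -
  define X where "X = {A. A \<subseteq> U \<and> card A \<le> Suc d}"
  from f obtain c where c: "\<And>S. S \<in> ksets U k \<Longrightarrow> f S = (\<Sum>A\<in>X. c A * of_bool (A \<subseteq> S))"
    unfolding low_degree_def X_def by blast
  define h where "h A S = c A * ((eigenvalue (card U) (card A) - eigenvalue (card U) (Suc d)) *
      of_bool (A \<subseteq> S) - (real k - real (card A) + 1) * (\<Sum>i\<in>A. of_bool (A - {i} \<subseteq> S)))" for A S
  have "laplacian U f S - eigenvalue (card U) (Suc d) * f S = (\<Sum>A\<in>X. h A S)"
    if S: "S \<in> ksets U k" for S
  proof -
    have "laplacian U f S = laplacian U (\<lambda>S. \<Sum>A\<in>X. c A * of_bool (A \<subseteq> S)) S"
      using U S c by (rule laplacian_cong)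
    also have "\<dots> = (\<Sum>A\<in>X. c A * (eigenvalue (card U) (card A) * of_bool (A \<subseteq> S) -
        (real k - real (card A) + 1) * (\<Sum>i\<in>A. of_bool (A - {i} \<subseteq> S))))"
      unfolding laplacian_sum laplacian_scale
      by (intro sum.cong refl) (simp add: laplacian_subset_indicator[OF U S] X_def)
    finally show ?thesis using S
      by (simp add: c h_def sum_distrib_left sum_subtractf[symmetric] algebra_simps)
  qed
  moreover have "low_degree U k d (\<lambda>S. \<Sum>A\<in>X. h A S)"
  proof (rule low_degree_sum)
    fix A assume A: "A \<in> X"
    then have finA: "finite A" using U finite_subset by (auto simp: X_def)
    have *: "low_degree U k d (\<lambda>S. \<Sum>i\<in>A. of_bool (A - {i} \<subseteq> S))"
      using A finA U by (intro low_degree_sum low_degree_subset_indicator) (auto simp: X_def)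
    have **: "low_degree U k d (\<lambda>S. (eigenvalue (card U) (card A) - eigenvalue (card U) (Suc d)) *
      of_bool (A \<subseteq> S))"
    proof (cases "card A \<le> d")
      case True
      then show ?thesis
        using A U by (intro low_degree_scale low_degree_subset_indicator) (auto simp: X_def)
    next
      case False
      then have "card A = Suc d" using A by (auto simp: X_def)
      then show ?thesis by (simp add: low_degree_zero)
    qed
    show "low_degree U k d (h A)"
      using low_degree_scale[OF low_degree_add[OF ** low_degree_scale[OF *, of "- (real k - real (card A) + 1)"]], of "c A"]
      unfolding h_def[abs_def] diff_conv_add_uminus by (simp only: mult_minus_left)
  qed
  ultimately show ?thesis by (subst low_degree_cong)
qed

section \<open>Orthogonal decomposition into eigenfunctions\<close>

lemma eigenvalue_neq:
  assumes "i < j" "i + j \<le> n"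
  shows "eigenvalue n i \<noteq> eigenvalue n j"
proof -
  have "eigenvalue n j - eigenvalue n i = (real j - real i) * (real n + 1 - real i - real j)"
    by (simp add: eigenvalue_def algebra_simps)
  also have "\<dots> \<noteq> 0" using assms by simp
  finally show ?thesis by simp
qed

text \<open>Apply the induction hypothesis to the image of \<open>f\<close> under the Laplacian
  minus its top eigenvalue. Dividing each component by its eigenvalue gap gives a preimage of this
  image, and \<open>f\<close> minus that preimage is an eigenfunction of the top level.\<close>

lemma low_degree_eigendecomposition:
  assumes U: "finite U" and "2 * d \<le> card U" "low_degree U k d f"
  shows "\<exists>g. (\<forall>j\<le>d. \<forall>S\<in>ksets U k. laplacian U (g j) S = eigenvalue (card U) j * g j S) \<and>
    (\<forall>S\<in>ksets U k. f S = (\<Sum>j\<le>d. g j S))"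
  using assms(2,3)
proof (induction d arbitrary: f)
  case 0
  have "{A. A \<subseteq> U \<and> card A \<le> 0} = {{}}" using U finite_subset[OF _ U] by fastforce
  then obtain c where c: "\<And>S. S \<in> ksets U k \<Longrightarrow> f S = c"
    using 0 unfolding low_degree_def by auto
  have "laplacian U f S = 0" if "S \<in> ksets U k" for S
    using laplacian_cong[OF U that, of f "\<lambda>_. c"] c by (simp add: laplacian_def)
  then show ?case by (intro exI[of _ "\<lambda>_. f"]) (simp add: eigenvalue_def)
next
  case (Suc d)
  define \<mu> where "\<mu> = eigenvalue (card U)"
  from Suc.IH[OF _ low_degree_laplacian_diff[OF U Suc.prems(2)]] Suc.prems(1)
  obtain g where g: "\<And>j S. j \<le> d \<Longrightarrow> S \<in> ksets U k \<Longrightarrow> laplacian U (g j) S = \<mu> j * g j S"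
    and sum: "\<And>S. S \<in> ksets U k \<Longrightarrow> laplacian U f S - \<mu> (Suc d) * f S = (\<Sum>j\<le>d. g j S)"
    unfolding \<mu>_def by fastforce
  define h where "h j S = 1 / (\<mu> j - \<mu> (Suc d)) * g j S" for j S
  define r where "r = (\<lambda>S. f S - (\<Sum>j\<le>d. h j S))"
  have neq: "\<mu> j \<noteq> \<mu> (Suc d)" if "j \<le> d" for j
    using that Suc.prems(1) unfolding \<mu>_def by (intro eigenvalue_neq) auto
  have h: "laplacian U (h j) S = \<mu> j * h j S" if "j \<le> d" "S \<in> ksets U k" for j S
    using g[OF that] by (simp add: h_def[abs_def] laplacian_scale del: times_divide_eq_left)
  have r: "laplacian U r S = \<mu> (Suc d) * r S" if S: "S \<in> ksets U k" for S
  proof -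
    have "laplacian U r S = laplacian U f S - (\<Sum>j\<le>d. \<mu> j * h j S)"
      using h S by (simp add: r_def laplacian_diff laplacian_sum)
    also have "(\<Sum>j\<le>d. \<mu> j * h j S) = (\<Sum>j\<le>d. g j S + \<mu> (Suc d) * h j S)"
      using neq by (intro sum.cong refl) (simp add: h_def field_simps)
    finally show ?thesis
      using sum[OF S] by (simp add: r_def sum.distrib sum_distrib_left algebra_simps)
  qed
  show ?case
    using h r unfolding \<mu>_def[symmetric]
    by (intro exI[of _ "\<lambda>j. if j = Suc d then r else h j"]) (auto simp: r_def le_Suc_eq)
qed

lemma eigenfunctions_orthogonal:
  assumes U: "finite U" and "\<mu> \<noteq> \<nu>"
    and f: "\<And>S. S \<in> ksets U (Suc k) \<Longrightarrow> laplacian U f S = \<mu> * f S"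
    and g: "\<And>S. S \<in> ksets U (Suc k) \<Longrightarrow> laplacian U g S = \<nu> * g S"
  shows "(\<Sum>S\<in>ksets U (Suc k). f S * g S) = 0"
proof -
  have "\<nu> * (\<Sum>S\<in>ksets U (Suc k). f S * g S) = \<mu> * (\<Sum>S\<in>ksets U (Suc k). f S * g S)"
    using laplacian_self_adjoint[OF U, where h = f and f = g and k = k] f g
    by (simp add: sum_distrib_left mult_ac)
  then show ?thesis using assms(2) by simp
qed

section \<open>Combining the levels\<close>

lemma sum_power4_le:
  fixes f :: "'a \<Rightarrow> real"
  shows "(\<Sum>x\<in>A. f x) ^ 4 \<le> real (card A) ^ 3 * (\<Sum>x\<in>A. f x ^ 4)"
proof -
  \<comment> \<open>Cauchy--Schwarz against the constant 1. Used twice, it produces the cube that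
    becomes \<open>(d + 1)^3\<close> for \<open>d + 1\<close> levels.\<close>
  have square: "(\<Sum>x\<in>A. g x)\<^sup>2 \<le> real (card A) * (\<Sum>x\<in>A. (g x)\<^sup>2)" for g :: "'a \<Rightarrow> real"
    using sum_squared_le_sum_of_squares[of g A] by (cases "finite A") (auto simp: mult.commute)
  have "(\<Sum>x\<in>A. f x) ^ 4 = ((\<Sum>x\<in>A. f x)\<^sup>2)\<^sup>2" by simp
  also have "\<dots> \<le> (real (card A) * (\<Sum>x\<in>A. (f x)\<^sup>2))\<^sup>2"
    by (rule power_mono[OF square]) simp
  also have "\<dots> \<le> (real (card A))\<^sup>2 * (real (card A) * (\<Sum>x\<in>A. ((f x)\<^sup>2)\<^sup>2))"
    by (simp only: power_mult_distrib) (intro mult_left_mono square, simp)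
  finally show ?thesis
    by (simp add: power2_eq_square[of "real (card A)"] power3_eq_cube mult.assoc)
qed

lemma sum_squares_le_square_sum:
  fixes f :: "'a \<Rightarrow> real"
  assumes "\<And>x. x \<in> A \<Longrightarrow> 0 \<le> f x"
  shows "(\<Sum>x\<in>A. (f x)\<^sup>2) \<le> (\<Sum>x\<in>A. f x)\<^sup>2"
  using assms
proof (induction A rule: infinite_finite_induct)
  case (insert x A)
  then have "0 \<le> f x * sum f A" by (auto intro!: mult_nonneg_nonneg sum_nonneg)
  moreover have "(\<Sum>x\<in>A. (f x)\<^sup>2) \<le> (sum f A)\<^sup>2" using insert by auto
  ultimately show ?case using insert by (simp add: power2_sum)
qed auto

lemma low_degree_fourth_moment_le:
  assumes U: "finite U" and d: "d < k" "k + d < card U" and f: "low_degree U k d f"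
    and C: "\<And>j. j \<le> d \<Longrightarrow> 9 ^ j \<le> C * real ((card U - 2 * j) choose (k - j))"
  shows "(\<Sum>S\<in>ksets U k. f S ^ 4) \<le> real (Suc d) ^ 3 * C * (\<Sum>S\<in>ksets U k. (f S)\<^sup>2)\<^sup>2"
proof -
  obtain k' where k: "k = Suc k'" using d by (cases k) auto
  from low_degree_eigendecomposition[OF U _ f] d
  obtain g where g: "\<And>j S. j \<le> d \<Longrightarrow> S \<in> ksets U k \<Longrightarrow> laplacian U (g j) S = eigenvalue (card U) j * g j S"
    and sum: "\<And>S. S \<in> ksets U k \<Longrightarrow> f S = (\<Sum>j\<le>d. g j S)"
    by fastforce
  \<comment> \<open>The sign of \<open>C\<close> is read off from level 0.\<close>
  have "0 < C * real (card U choose k)" using C[of 0] by simp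
  then have C0: "0 \<le> C" by (simp add: zero_less_mult_iff)
  have comp: "(\<Sum>S\<in>ksets U k. g j S ^ 4) \<le> C * (\<Sum>S\<in>ksets U k. (g j S)\<^sup>2)\<^sup>2" if "j \<le> d" for j
  proof -
    define b where "b = real ((card U - 2 * j) choose (k - j))"
    have b: "0 < b" using that d by (simp add: b_def)
    have "b * (\<Sum>S\<in>ksets U k. g j S ^ 4) \<le> 9 ^ j * (\<Sum>S\<in>ksets U k. (g j S)\<^sup>2)\<^sup>2"
      unfolding b_def using that d g by (intro eigenfunction_fourth_moment_le U) auto
    also have "\<dots> \<le> C * b * (\<Sum>S\<in>ksets U k. (g j S)\<^sup>2)\<^sup>2"
      using C[OF that] by (intro mult_right_mono) (auto simp: b_def)
    finally show ?thesis using b by (simp add: mult_ac)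
  qed
  have orth: "(\<Sum>S\<in>ksets U k. g i S * g j S) = 0" if "i \<le> d" "j \<le> d" "i < j" for i j
    unfolding k
    by (rule eigenfunctions_orthogonal[OF U eigenvalue_neq[of i j "card U"]])
      (use that d g k in auto)
  have orth': "(\<Sum>S\<in>ksets U k. g i S * g j S) = 0" if "i \<le> d" "j \<le> d" "i \<noteq> j" for i j
  proof (cases "i < j")
    case False
    have "(\<Sum>S\<in>ksets U k. g i S * g j S) = (\<Sum>S\<in>ksets U k. g j S * g i S)"
      by (intro sum.cong refl mult.commute)
    then show ?thesis using orth[of j i] that False by simp
  qed (use that orth in auto)
  have "(\<Sum>S\<in>ksets U k. (f S)\<^sup>2) = (\<Sum>S\<in>ksets U k. \<Sum>i\<le>d. \<Sum>j\<le>d. g i S * g j S)"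
    by (simp add: sum power2_eq_square sum_product)
  also have "\<dots> = (\<Sum>i\<le>d. \<Sum>j\<le>d. \<Sum>S\<in>ksets U k. g i S * g j S)"
    by (simp add: sum.swap[of _ "ksets U k"])
  also have "\<dots> = (\<Sum>i\<le>d. \<Sum>j\<le>d. if j = i then \<Sum>S\<in>ksets U k. (g i S)\<^sup>2 else 0)"
    using orth' by (intro sum.cong refl) (auto simp: power2_eq_square)
  also have "\<dots> = (\<Sum>i\<le>d. \<Sum>S\<in>ksets U k. (g i S)\<^sup>2)"
    by simp
  finally have parseval: "(\<Sum>S\<in>ksets U k. (f S)\<^sup>2) = (\<Sum>i\<le>d. \<Sum>S\<in>ksets U k. (g i S)\<^sup>2)" .
  have "(\<Sum>S\<in>ksets U k. f S ^ 4) \<le> (\<Sum>S\<in>ksets U k. real (Suc d) ^ 3 * (\<Sum>j\<le>d. g j S ^ 4))"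
    using sum_power4_le[of "\<lambda>j. g j S" "{..d}" for S] by (intro sum_mono) (simp add: sum)
  also have "\<dots> = real (Suc d) ^ 3 * (\<Sum>j\<le>d. \<Sum>S\<in>ksets U k. g j S ^ 4)"
    by (simp add: sum_distrib_left[symmetric] sum.swap[of _ "ksets U k"])
  also have "\<dots> \<le> real (Suc d) ^ 3 * (\<Sum>j\<le>d. C * (\<Sum>S\<in>ksets U k. (g j S)\<^sup>2)\<^sup>2)"
    by (intro mult_left_mono sum_mono comp) auto
  also have "\<dots> = real (Suc d) ^ 3 * (C * (\<Sum>j\<le>d. (\<Sum>S\<in>ksets U k. (g j S)\<^sup>2)\<^sup>2))"
    by (simp add: sum_distrib_left)
  \<comment> \<open>The squared norms of the components are nonnegative and by
    \<open>parseval\<close> add up to that of \<open>f\<close>.\<close>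
  also have "\<dots> \<le> real (Suc d) ^ 3 * (C * (\<Sum>j\<le>d. \<Sum>S\<in>ksets U k. (g j S)\<^sup>2)\<^sup>2)"
    using C0 by (intro mult_left_mono sum_squares_le_square_sum sum_nonneg) auto
  finally show ?thesis by (simp add: parseval mult.assoc)
qed

subsection \<open>The ratio of binomial coefficients\<close>

text \<open>\<open>j^j / j!\<close> is a single term of the exponential series at
  \<open>j\<close>.\<close>

lemma power_self_le_exp_fact: "real j ^ j \<le> exp 1 ^ j * fact j"
proof -
  have "real j ^ j / fact j \<le> exp (real j)"
    unfolding exp_def using sum_le_suminf[OF summable_exp_generic, of "{j}" "real j"]
    by (simp add: divide_inverse mult.commute)
  then show ?thesis by (simp add: field_simps exp_of_nat_mult[symmetric])
qed

text \<open>A lower bound \<open>(k / e)^j\<close> for the falling factorial, from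
  \<open>(k / j)^j \<le> (k choose j)\<close> and \<open>(j / e)^j \<le> j!\<close>.\<close>

lemma power_le_fact_quotient:
  assumes "j \<le> k"
  shows "real k ^ j \<le> exp 1 ^ j * (fact k / fact (k - j))"
proof (cases "j = 0")
  case False
  have "real k ^ j \<le> real j ^ j * real (k choose j)"
    using binomial_ge_n_over_k_pow_k[OF assms, where 'a = real] False
    by (simp add: power_divide field_simps)
  also have "\<dots> \<le> exp 1 ^ j * fact j * real (k choose j)"
    by (intro mult_right_mono power_self_le_exp_fact) simp
  finally show ?thesis using assms by (simp add: binomial_fact)
qed simp

text \<open>With \<open>m = n - k\<close>, the ratio is \<open>n! / (n - 2 j)!\<close>, at most
  \<open>n^(2 j)\<close>, divided by the falling factorials of \<open>k = p n\<close> and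
  \<open>m = (1 - p) n\<close>, at least \<open>(k / e)^j\<close> and \<open>(m / e)^j\<close>. The
  powers of \<open>n\<close> cancel.\<close>

lemma binomial_ratio_le:
  assumes p: "0 < p" "p < 1" and k: "real k = p * real n" and n: "0 < n" and j: "j \<le> k" "j + k \<le> n"
  shows "real (n choose k) \<le> (exp 2 / (p * (1 - p))) ^ j * real ((n - 2 * j) choose (k - j))"
proof -
  define m where "m = n - k"
  have m: "n = k + m" "j \<le> m" using j by (auto simp: m_def)
  have realm: "real m = (1 - p) * real n" using k m by (simp add: algebra_simps)
  have "n - 2 * j - (k - j) = m - j" "k - j \<le> n - 2 * j" using m j by auto
  then have binom: "real ((n - 2 * j) choose (k - j)) = fact (n - 2 * j) / (fact (k - j) * fact (m - j))"
    by (simp add: binomial_fact)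
  have "(fact n :: real) / fact (n - 2 * j) \<le> real n ^ (2 * j)"
  proof -
    have "real (fact n div fact (n - 2 * j)) \<le> real (n ^ (2 * j))"
      using fact_div_fact_le_pow[of "2 * j" n] j m by (simp only: of_nat_le_iff)
    then show ?thesis by (simp add: real_of_nat_div fact_dvd)
  qed
  then have "p ^ j * (1 - p) ^ j * ((fact n :: real) / fact (n - 2 * j)) \<le> p ^ j * (1 - p) ^ j * real n ^ (2 * j)"
    using p by (intro mult_left_mono) auto
  also have "\<dots> = real k ^ j * real m ^ j"
    by (simp add: k realm power_mult_distrib mult_2 power_add)
  also have "\<dots> \<le> (exp 1 ^ j * (fact k / fact (k - j))) * (exp 1 ^ j * (fact m / fact (m - j)))"
    by (intro mult_mono power_le_fact_quotient j m) auto
  also have "\<dots> = exp 2 ^ j * (fact k * fact m / (fact (k - j) * fact (m - j)))"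
  proof -
    have "exp 2 = exp 1 * exp (1 :: real)" by (simp add: exp_add[symmetric])
    then show ?thesis by (simp add: power_mult_distrib)
  qed
  finally have "p ^ j * (1 - p) ^ j * ((fact n :: real) / fact (n - 2 * j)) * fact (n - 2 * j)
      / (fact k * fact m) \<le>
    exp 2 ^ j * (fact k * fact m / (fact (k - j) * fact (m - j))) * fact (n - 2 * j) / (fact k * fact m)"
    by (intro divide_right_mono mult_right_mono) auto
  then have "p ^ j * (1 - p) ^ j * real (n choose k) \<le> exp 2 ^ j * real ((n - 2 * j) choose (k - j))"
    using m unfolding binom by (simp add: binomial_fact)
  then have "real (n choose k) * (p * (1 - p)) ^ j \<le> exp 2 ^ j * real ((n - 2 * j) choose (k - j))"
    by (simp add: power_mult_distrib mult_ac)
  then show ?thesis using p by (simp add: power_divide pos_le_divide_eq)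
qed

subsection \<open>The slice as a family of sets\<close>

text \<open>Each sign is one minus twice a membership indicator; expanding the product gives
  indicators of subsets of \<open>A\<close>.\<close>

lemma low_degree_prod:
  assumes "finite U" "A \<subseteq> U" "card A \<le> d"
  shows "low_degree U k d (\<lambda>S. \<Prod>i\<in>A. if i \<in> S then - 1 else 1)"
proof -
  have finA: "finite A" using assms finite_subset by blast
  have "(\<Prod>i\<in>A. if i \<in> S then - 1 else (1 :: real)) =
      (\<Sum>B\<in>Pow A. (- 2) ^ card B * of_bool (B \<subseteq> S))" for S
  proof -
    have "(\<Prod>i\<in>A. if i \<in> S then - 1 else (1 :: real)) = (\<Prod>i\<in>A. - 2 * of_bool (i \<in> S) + 1)"
      by (intro prod.cong) auto
    also have "\<dots> = (\<Sum>B\<in>Pow A. \<Prod>i\<in>B. - 2 * of_bool (i \<in> S))"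
      using finA by (subst prod_add) auto
    also have "\<dots> = (\<Sum>B\<in>Pow A. (- 2) ^ card B * of_bool (B \<subseteq> S))"
    proof (intro sum.cong refl)
      fix B assume "B \<in> Pow A"
      then have "finite B" using finA finite_subset by auto
      then have "(\<Prod>i\<in>B. of_bool (i \<in> S) :: real) = of_bool (B \<subseteq> S)"
        by (induction B rule: finite_induct) auto
      then show "(\<Prod>i\<in>B. - 2 * of_bool (i \<in> S) :: real) = (- 2) ^ card B * of_bool (B \<subseteq> S)"
        by (simp only: prod.distrib prod_constant)
    qed
    finally show ?thesis .
  qed
  moreover have "low_degree U k d (\<lambda>S. \<Sum>B\<in>Pow A. (- 2) ^ card B * of_bool (B \<subseteq> S))"
  proof (intro low_degree_sum low_degree_scale low_degree_subset_indicator)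
    fix B assume "B \<in> Pow A"
    then show "B \<subseteq> U" "card B \<le> d" using assms card_mono[OF finA, of B] by auto
  qed (rule assms(1))
  ultimately show ?thesis by simp
qed

text \<open>\<open>S\<close> marks the coordinates equal to -1, so the slice corresponds to
  \<open>card S = p n\<close>. Restriction to \<open>{1..n}\<close> makes the vector extensional, as
  in \<open>slice\<close>.\<close>

definition sign_vector :: "nat \<Rightarrow> nat set \<Rightarrow> nat \<Rightarrow> real" where
  "sign_vector n S = (\<lambda>i\<in>{1..n}. if i \<in> S then - 1 else 1)"

lemma sum_sign_vector:
  assumes "S \<subseteq> {1..n}"
  shows "(\<Sum>i=1..n. sign_vector n S i) = real n - 2 * real (card S)"
proof -
  have "(\<Sum>i=1..n. sign_vector n S i) = (\<Sum>i=1..n. 1 - 2 * of_bool (i \<in> S))"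
    by (intro sum.cong) (auto simp: sign_vector_def)
  also have "(\<Sum>i=1..n. of_bool (i \<in> S) :: real) = real (card S)"
    using assms by (simp add: sum.If_cases of_bool_def Int_absorb1)
  then have "(\<Sum>i=1..n. 1 - 2 * of_bool (i \<in> S)) = real n - 2 * real (card S)"
    by (simp add: sum_subtractf sum_distrib_left[symmetric])
  finally show ?thesis .
qed

lemma bij_betw_sign_vector:
  assumes "real k = p * real n"
  shows "bij_betw (sign_vector n) (ksets {1..n} k) (slice n p)"
proof -
  have inv: "{i \<in> {1..n}. sign_vector n S i = - 1} = S" if "S \<subseteq> {1..n}" for S
    using that by (auto simp: sign_vector_def)
  have inv': "sign_vector n {i \<in> {1..n}. x i = - 1} = x" if "x \<in> {1..n} \<rightarrow>\<^sub>E {- 1, 1}" for x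
    using that by (fastforce simp: sign_vector_def fun_eq_iff PiE_def extensional_def)
  have memb: "sign_vector n S \<in> {1..n} \<rightarrow>\<^sub>E {- 1, 1}" for S
    by (auto simp: sign_vector_def)
  have card: "card S = k" if "S \<subseteq> {1..n}" "(\<Sum>i=1..n. sign_vector n S i) = (1 - 2 * p) * real n" for S
  proof -
    have "real (card S) = real k"
      using that(2) assms unfolding sum_sign_vector[OF that(1)] by (simp add: algebra_simps)
    then show ?thesis by simp
  qed
  have sub: "{i \<in> {1..n}. x i = - 1} \<subseteq> {1..n}" for x :: "nat \<Rightarrow> real" by auto
  show ?thesis
  proof (rule bij_betw_byWitness[where f' = "\<lambda>x. {i \<in> {1..n}. x i = - 1}"])
    show "\<forall>S\<in>ksets {1..n} k. {i \<in> {1..n}. sign_vector n S i = - 1} = S"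
      using inv by (auto simp: ksets_def)
    show "\<forall>x\<in>slice n p. sign_vector n {i \<in> {1..n}. x i = - 1} = x"
      using inv' by (auto simp: slice_def)
    show "sign_vector n ` ksets {1..n} k \<subseteq> slice n p"
    proof (intro image_subsetI)
      fix S assume S: "S \<in> ksets {1..n} k"
      then have "(\<Sum>i=1..n. sign_vector n S i) = real n - 2 * real k"
        using sum_sign_vector[of S n] by (simp add: ksets_def)
      also have "\<dots> = (1 - 2 * p) * real n"
        using assms by (simp add: algebra_simps)
      finally show "sign_vector n S \<in> slice n p"
        using memb by (simp add: slice_def)
    qed
    show "(\<lambda>x. {i \<in> {1..n}. x i = - 1}) ` slice n p \<subseteq> ksets {1..n} k"
    proof (intro image_subsetI)
      fix x assume "x \<in> slice n p"
      then have x: "x \<in> {1..n} \<rightarrow>\<^sub>E {- 1, 1}" "(\<Sum>i=1..n. x i) = (1 - 2 * p) * real n"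
        by (simp_all add: slice_def)
      show "{i \<in> {1..n}. x i = - 1} \<in> ksets {1..n} k"
        using card[OF sub, of x] sub x(2) unfolding inv'[OF x(1)] by (simp add: ksets_def)
    qed
  qed
qed

lemma expectation_slice_pmf:
  fixes f :: "(nat \<Rightarrow> real) \<Rightarrow> real"
  assumes "real k = p * real n" "k \<le> n"
  shows "measure_pmf.expectation (slice_pmf n p) f =
    (\<Sum>S\<in>ksets {1..n} k. f (sign_vector n S)) / real (n choose k)"
proof -
  note bij = bij_betw_sign_vector[OF assms(1)]
  have "card (slice n p) = n choose k"
    using bij_betw_same_card[OF bij] by (simp add: card_ksets)
  moreover from this have "finite (slice n p)" "slice n p \<noteq> {}"
    using assms(2) zero_less_binomial[of k n] by (auto intro: card_ge_0_finite)
  moreover have "(\<Sum>x\<in>slice n p. f x) = (\<Sum>S\<in>ksets {1..n} k. f (sign_vector n S))"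
    by (rule sum.reindex_bij_betw[OF bij, symmetric])
  ultimately show ?thesis by (simp add: slice_pmf_def integral_pmf_of_set)
qed

text \<open>Multilinearity forces every exponent on the support to be 1, so a monomial is a product
  of distinct signs whose number is its degree.\<close>

lemma low_degree_eval_mpoly:
  assumes vars: "mvars f \<subseteq> {1..n}" and ml: "multilinear_mpoly f"
  shows "low_degree {1..n} k (total_degree f) (\<lambda>S. eval_mpoly f (sign_vector n S))"
  unfolding eval_mpoly_def
proof (intro low_degree_sum low_degree_scale)
  fix m assume m: "m \<in> Poly_Mapping.keys f"
  have sub: "Poly_Mapping.keys m \<subseteq> {1..n}" using vars m by (auto simp: mvars_def)
  have one: "Poly_Mapping.lookup m i = 1" if "i \<in> Poly_Mapping.keys m" for i
  proof -
    have "Poly_Mapping.lookup m i \<le> 1" using ml m by (auto simp: multilinear_mpoly_def)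
    moreover have "Poly_Mapping.lookup m i \<noteq> 0" using that by (simp add: in_keys_iff)
    ultimately show ?thesis by linarith
  qed
  have "card (Poly_Mapping.keys m) = monomial_degree m"
    by (simp add: monomial_degree_def one)
  also have "\<dots> \<le> total_degree f"
    unfolding total_degree_def using m by (intro Max_ge) auto
  finally have "low_degree {1..n} k (total_degree f)
      (\<lambda>S. \<Prod>i\<in>Poly_Mapping.keys m. if i \<in> S then - 1 else 1)"
    using sub by (intro low_degree_prod) auto
  moreover have "(\<Prod>i\<in>Poly_Mapping.keys m. sign_vector n S i ^ Poly_Mapping.lookup m i) =
      (\<Prod>i\<in>Poly_Mapping.keys m. if i \<in> S then - 1 else 1)" for S
    using sub by (intro prod.cong refl) (auto simp: one sign_vector_def)
  ultimately show "low_degree {1..n} k (total_degree f)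
      (\<lambda>S. \<Prod>i\<in>Poly_Mapping.keys m. sign_vector n S i ^ Poly_Mapping.lookup m i)"
    by simp
qed

section \<open>The two degree ranges and the explicit constants\<close>

lemma low_degree_hypercontractive:
  assumes p: "0 < p" "p < 1" and k: "real k = p * real n" and n: "0 < n"
    and f: "low_degree {1..n} k d f"
  shows "(\<Sum>S\<in>ksets {1..n} k. f S ^ 4) / real (n choose k) \<le>
    real (Suc d) ^ 3 * (9 * exp 2 / (p * (1 - p))) ^ d *
      ((\<Sum>S\<in>ksets {1..n} k. (f S)\<^sup>2) / real (n choose k))\<^sup>2"
proof -
  \<comment> \<open>The 9 is the cost per level of the eigenfunction bound, the rest is the base in
    the binomial ratio.\<close>
  define Q where "Q = 9 * exp 2 / (p * (1 - p))"
  define N where "N = real (n choose k)"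
  define B where "B = (\<Sum>S\<in>ksets {1..n} k. (f S)\<^sup>2)"
  have "real k < real n" using p n unfolding k by simp
  then have kn: "k < n" by simp
  then have N: "0 < N" by (simp add: N_def)
  have ratio: "9 ^ j * N \<le> Q ^ j * real ((n - 2 * j) choose (k - j))" if "j \<le> k" "j + k \<le> n" for j
    using mult_left_mono[OF binomial_ratio_le[OF p k n that], of "9 ^ j"]
    by (simp add: N_def Q_def mult.assoc[symmetric] power_mult_distrib[symmetric])
  have Q: "1 \<le> Q"
  proof -
    have "p * (1 - p) \<le> 1 * 1" using p by (intro mult_mono) auto
    also have "\<dots> \<le> 9 * exp 2" using one_le_exp_iff[of "2 :: real"] by linarith
    finally show ?thesis using p by (simp add: Q_def)
  qed
  show ?thesis
  proof (cases "d < k \<and> k + d < n")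
    case True
    have "(\<Sum>S\<in>ksets {1..n} k. f S ^ 4) \<le> real (Suc d) ^ 3 * (Q ^ d / N) * B\<^sup>2"
      unfolding B_def
    proof (rule low_degree_fourth_moment_le)
      fix j assume j: "j \<le> d"
      have "9 ^ j * N \<le> Q ^ j * real ((n - 2 * j) choose (k - j))"
        using True j by (intro ratio) auto
      also have "\<dots> \<le> Q ^ d * real ((n - 2 * j) choose (k - j))"
        using Q j by (intro mult_right_mono power_increasing) auto
      finally show "9 ^ j \<le> Q ^ d / N * real ((card {1..n} - 2 * j) choose (k - j))"
        using N by (simp add: pos_le_divide_eq)
    qed (use True f in auto)
    then have "(\<Sum>S\<in>ksets {1..n} k. f S ^ 4) / N \<le> real (Suc d) ^ 3 * (Q ^ d / N) * B\<^sup>2 / N"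
      using N by (intro divide_right_mono) auto
    also have "\<dots> = real (Suc d) ^ 3 * Q ^ d * (B / N)\<^sup>2"
      by (simp add: power2_eq_square)
    finally show ?thesis by (simp add: B_def N_def Q_def)
  next
    case False
    \<comment> \<open>At level \<open>m\<close> the binomial \<open>(n - 2 m) choose (k - m)\<close>
      equals 1, so \<open>ratio\<close> bounds \<open>N\<close> by \<open>Q ^ m\<close>, hence by
      \<open>Q ^ d\<close>.\<close>
    define m where "m = min k (n - k)"
    have m: "m \<le> d" "m \<le> k" "m + k \<le> n" using False kn by (auto simp: m_def)
    have "(n - 2 * m) choose (k - m) = 1"
    proof (cases "k \<le> n - k")
      case False
      then have "k - m = n - 2 * m" using kn by (auto simp: m_def)
      then show ?thesis by simp
    qed (simp add: m_def)
    then have "1 * N \<le> Q ^ m"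
      using ratio[OF m(2,3)] N by (intro order_trans[OF mult_right_mono[of 1 "9 ^ m" N]]) auto
    also have "\<dots> \<le> 1 * Q ^ d" using Q m(1) by (simp add: power_increasing)
    also have "\<dots> \<le> real (Suc d) ^ 3 * Q ^ d"
      using Q by (intro mult_right_mono one_le_power) auto
    finally have NQ: "N \<le> real (Suc d) ^ 3 * Q ^ d" by simp
    have "(\<Sum>S\<in>ksets {1..n} k. f S ^ 4) \<le> B\<^sup>2"
      using sum_squares_le_square_sum[of "ksets {1..n} k" "\<lambda>S. (f S)\<^sup>2"] by (simp add: B_def)
    then have "(\<Sum>S\<in>ksets {1..n} k. f S ^ 4) / N \<le> B\<^sup>2 / N"
      using N by (intro divide_right_mono) auto
    \<comment> \<open>Normalising the trivial inequality between the unnormalised sums costs one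
      factor \<open>N\<close>.\<close>
    also have "\<dots> = N * (B / N)\<^sup>2"
      using N by (simp add: power2_eq_square)
    also have "\<dots> \<le> real (Suc d) ^ 3 * Q ^ d * (B / N)\<^sup>2"
      by (intro mult_right_mono NQ) simp
    finally show ?thesis by (simp add: B_def N_def Q_def)
  qed
qed

theorem theorem1p2:
  "\<exists>(P :: real poly) (R :: real poly poly).
     \<forall>(p :: real) (n :: nat) (f :: mpolynomial) (d :: nat).
       0 < p \<longrightarrow> p < 1 \<longrightarrow> 0 < n \<longrightarrow> p * real n \<in> \<int> \<longrightarrow>
       mvars f \<subseteq> {1..n} \<longrightarrow> multilinear_mpoly f \<longrightarrow> total_degree f = d \<longrightarrow>
       measure_pmf.expectation (slice_pmf n p) (\<lambda>x. eval_mpoly f x ^ 4)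
         \<le> poly P (real d) * eval_poly2 R (1 / (1 - p)) (1 / p) ^ d *
            (measure_pmf.expectation (slice_pmf n p) (\<lambda>x. eval_mpoly f x ^ 2)) ^ 2"
proof (intro exI allI impI)
  fix p :: real and n d :: nat and f :: mpolynomial
  assume p: "0 < p" "p < 1" and n: "0 < n" and int: "p * real n \<in> \<int>"
    and f: "mvars f \<subseteq> {1..n}" "multilinear_mpoly f" "total_degree f = d"
  have "0 \<le> p * real n" using p by simp
  with int obtain k where k: "real k = p * real n"
    by (metis Ints_cases of_int_0_le_iff of_int_of_nat_eq zero_le_imp_eq_int)
  have "real k \<le> real n" using p k by (simp add: mult_left_le_one_le)
  then have kn: "k \<le> n" by simp
  \<comment> \<open>The witnesses are \<open>P(X) = (1 + X)^3\<close> and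
    \<open>R(a, b) = 9 e^2 a b\<close>.\<close>
  have P: "poly ([:1, 1:] ^ 3) (real d) = real (Suc d) ^ 3"
    by (simp add: poly_power)
  have R: "eval_poly2 [:0, [:0, 9 * exp 2:]:] (1 / (1 - p)) (1 / p) = 9 * exp 2 / (p * (1 - p))"
    by (simp add: eval_poly2_def)
  show "measure_pmf.expectation (slice_pmf n p) (\<lambda>x. eval_mpoly f x ^ 4)
      \<le> poly ([:1, 1:] ^ 3) (real d) * eval_poly2 [:0, [:0, 9 * exp 2:]:] (1 / (1 - p)) (1 / p) ^ d *
        (measure_pmf.expectation (slice_pmf n p) (\<lambda>x. eval_mpoly f x ^ 2)) ^ 2"
    unfolding P R expectation_slice_pmf[OF k kn]
    using low_degree_eval_mpoly[OF f(1,2), of k] p k n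
    by (intro low_degree_hypercontractive) (simp_all add: f(3))
qed

end
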